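(* Let $N\ge1$ and $L\ge 0$ be integers, $\sigma_b^2>0$ and $0<\sigma_w^2<1$, and put $\Delta_w=1-\sigma_w^2$. Consider the energy of the stochastic linear network on a ring, $$\mathcal L(\{r^l\})=\frac12\sum_{l=0}^L\left\{\frac{(r^l)^2}{\sigma_w^2N^{-1}(r^{l-1})^2+\sigma_b^2}-N\log\left(\frac{(r^l)^2}{\sigma_w^2N^{-1}(r^l)^2+\sigma_b^2}\right)\right\},$$ defined for $(r^0,\dots,r^L)\in(0,\infty)^{L+1}$ with the periodic identification $r^{-1}=r^L$. Then there is a constant configuration $r^l=r^*$ (independent of $l$) that minimizes $\mathcal L$, and it is given by $$r^*=\sqrt{\frac{N\sigma_b^2}{\Delta_w}}.$$
   Context: The superscript $l$ in $r^l$ is a layer index, not a power. In the source, $r^l$ is the Euclidean norm of the vector of pre-activations in layer $l$ of a random linear network of constant width $N$ with weight variance $\sigma_w^2/N$ and bias variance $\sigma_b^2$, whose last layer feeds back into its first layer. *)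

theory Defs
  imports Complex_Main "HOL-Library.FuncSet"
begin

text \<open>
  In \<open>r l\<close> the index \<open>l\<close> is the layer. Layers are numbered \<open>0, \<dots>, L\<close>, and the extensional
  function space makes a configuration exactly an \<open>(L + 1)\<close>-tuple of positive reals.
\<close>

definition configs :: "nat \<Rightarrow> (nat \<Rightarrow> real) set" where
  "configs L = ({0..L} \<rightarrow>\<^sub>E {0<..})"

definition const_config :: "nat \<Rightarrow> real \<Rightarrow> nat \<Rightarrow> real" where
  "const_config L c = (\<lambda>l\<in>{0..L}. c)"

definition prev_layer :: "nat \<Rightarrow> nat \<Rightarrow> nat" where
  "prev_layer L l = (if l = 0 then L else l - 1)"

text \<open>The argument of the logarithm involves only \<open>r l\<close>, not the preceding layer.\<close>

definition ring_energy :: "nat \<Rightarrow> nat \<Rightarrow> real \<Rightarrow> real \<Rightarrow> (nat \<Rightarrow> real) \<Rightarrow> real" where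
  "ring_energy N L \<sigma>\<^sub>w \<sigma>\<^sub>b r =
     1 / 2 * (\<Sum>l=0..L.
       (r l)\<^sup>2 / (\<sigma>\<^sub>w\<^sup>2 / real N * (r (prev_layer L l))\<^sup>2 + \<sigma>\<^sub>b\<^sup>2)
       - real N * ln ((r l)\<^sup>2 / (\<sigma>\<^sub>w\<^sup>2 / real N * (r l)\<^sup>2 + \<sigma>\<^sub>b\<^sup>2)))"

definition minimizes_energy :: "nat \<Rightarrow> nat \<Rightarrow> real \<Rightarrow> real \<Rightarrow> (nat \<Rightarrow> real) \<Rightarrow> bool" where
  "minimizes_energy N L \<sigma>\<^sub>w \<sigma>\<^sub>b r \<longleftrightarrow>
     is_arg_min (ring_energy N L \<sigma>\<^sub>w \<sigma>\<^sub>b) (\<lambda>s. s \<in> configs L) r"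

end

theory Submission
  imports Defs
begin

text \<open>
  Since the layers form a ring, \<open>\<Sum>l. ln (\<sigma>\<^sub>w\<^sup>2 / N * (r l)\<^sup>2 + \<sigma>\<^sub>b\<^sup>2)\<close> does not change when each
  layer is replaced by its predecessor. The energy is therefore half the sum of \<open>t - N * ln t\<close> over
  the ratios \<open>t = (r l)\<^sup>2 / (\<sigma>\<^sub>w\<^sup>2 / N * (r (l - 1))\<^sup>2 + \<sigma>\<^sub>b\<^sup>2)\<close>, and \<open>t - N * ln t\<close> has its unique
  minimum at \<open>t = N\<close>. For a constant configuration \<open>t = N\<close> is a linear equation in the square
  of the radius.
\<close>

text \<open>This is \<open>ln x \<le> x - 1\<close> at \<open>x = t / a\<close>, scaled by
  \<open>a\<close>.\<close>

lemma minus_mult_ln_ge: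
  fixes a t :: real
  assumes "a > 0" "t > 0"
  shows "a - a * ln a \<le> t - a * ln t"
proof -
  have "a * ln (t / a) \<le> a * (t / a - 1)"
    using assms by (intro mult_left_mono ln_le_minus_one) auto
  with assms show ?thesis
    by (simp add: ln_div algebra_simps)
qed

text \<open>The equality case: \<open>ln x = x - 1\<close> forces \<open>x = 1\<close>. It serves
  the uniqueness of the constant minimizer.\<close>

lemma minus_mult_ln_eq_imp_eq:
  fixes a t :: real
  assumes "a > 0" "t > 0" and eq: "t - a * ln t = a - a * ln a"
  shows "t = a"
proof -
  have "a * ln (t / a) = a * (t / a - 1)"
    using assms by (simp add: ln_div algebra_simps)
  then have "ln (t / a) = t / a - 1"
    using assms(1) by simp
  then have "t / a = 1"
    using assms by (intro ln_eq_minus_one) auto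
  with assms(1) show ?thesis by simp
qed

text \<open>\<open>prev_layer L\<close> rotates the ring and so permutes \<open>{0..L}\<close>; the
  witness \<open>i\<close> is the inverse rotation, which wraps \<open>L\<close> round to
  \<open>0\<close>.\<close>

lemma sum_prev_layer: "(\<Sum>l=0..L. f (prev_layer L l)) = (\<Sum>l=0..L. f l)"
  by (rule sum.reindex_bij_witness[where i = "\<lambda>l. if l = L then 0 else l + 1" and j = "prev_layer L"])
    (auto simp: prev_layer_def split: if_splits)

lemma prev_layer_le: "l \<le> L \<Longrightarrow> prev_layer L l \<le> L"
  by (auto simp: prev_layer_def)

lemma const_config_in_configs: "c > 0 \<Longrightarrow> const_config L c \<in> configs L"
  by (auto simp: const_config_def configs_def)

definition layer_ratio :: "nat \<Rightarrow> nat \<Rightarrow> real \<Rightarrow> real \<Rightarrow> (nat \<Rightarrow> real) \<Rightarrow> nat \<Rightarrow> real" where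
  "layer_ratio N L \<sigma>\<^sub>w \<sigma>\<^sub>b r l =
     (r l)\<^sup>2 / (\<sigma>\<^sub>w\<^sup>2 / real N * (r (prev_layer L l))\<^sup>2 + \<sigma>\<^sub>b\<^sup>2)"

lemma variance_pos:
  fixes x :: real
  assumes "\<sigma>\<^sub>b\<^sup>2 > 0"
  shows "\<sigma>\<^sub>w\<^sup>2 / real N * x\<^sup>2 + \<sigma>\<^sub>b\<^sup>2 > 0"
  using assms by (intro add_nonneg_pos) auto

lemma layer_ratio_pos:
  assumes "\<sigma>\<^sub>b\<^sup>2 > 0" "r \<in> configs L" "l \<le> L"
  shows "layer_ratio N L \<sigma>\<^sub>w \<sigma>\<^sub>b r l > 0"
proof -
  have "r l > 0" using assms by (auto simp: configs_def PiE_iff)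
  with variance_pos[OF assms(1)] show ?thesis
    by (simp add: layer_ratio_def)
qed

text \<open>In general the summands differ and only the totals agree. Afterwards each summand
  depends on one positive quantity, which allows a termwise bound.\<close>

lemma ring_energy_eq_sum_layer_ratio:
  assumes "\<sigma>\<^sub>b\<^sup>2 > 0" and r: "r \<in> configs L"
  shows "ring_energy N L \<sigma>\<^sub>w \<sigma>\<^sub>b r =
    1 / 2 * (\<Sum>l=0..L. layer_ratio N L \<sigma>\<^sub>w \<sigma>\<^sub>b r l - real N * ln (layer_ratio N L \<sigma>\<^sub>w \<sigma>\<^sub>b r l))"
proof -
  define d where "d x = \<sigma>\<^sub>w\<^sup>2 / real N * (r x)\<^sup>2 + \<sigma>\<^sub>b\<^sup>2" for x
  have d: "d x > 0" for x
    unfolding d_def by (rule variance_pos[OF assms(1)])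
  \<comment> \<open>Leaving \<open>k\<close> arbitrary lets one fact split the logarithm both for
    the layer's own denominator and for its predecessor's.\<close>
  have ln_ratio: "ln ((r l)\<^sup>2 / d k) = ln ((r l)\<^sup>2) - ln (d k)" if "l \<in> {0..L}" for l k
  proof -
    have "r l > 0" using r that by (auto simp: configs_def PiE_iff)
    with d[of k] show ?thesis by (simp add: ln_div)
  qed
  have "(\<Sum>l=0..L. ln ((r l)\<^sup>2 / d l)) = (\<Sum>l=0..L. ln ((r l)\<^sup>2 / d (prev_layer L l)))"
    using sum_prev_layer[of "\<lambda>l. ln (d l)" L]
    by (simp add: ln_ratio sum_subtractf)
  then show ?thesis
    by (simp add: ring_energy_def layer_ratio_def d_def sum_subtractf flip: sum_distrib_left)
qed

text \<open>Each ratio is bounded separately, ignoring the coupling between layers. Nothing is lost,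
  since a constant configuration can make all ratios equal \<open>N\<close> at once.\<close>

lemma ring_energy_ge:
  assumes "N \<ge> 1" "\<sigma>\<^sub>b\<^sup>2 > 0" "r \<in> configs L"
  shows "real (L + 1) / 2 * (real N - real N * ln (real N)) \<le> ring_energy N L \<sigma>\<^sub>w \<sigma>\<^sub>b r"
proof -
  have "(\<Sum>l=0..L. real N - real N * ln (real N)) \<le>
    (\<Sum>l=0..L. layer_ratio N L \<sigma>\<^sub>w \<sigma>\<^sub>b r l - real N * ln (layer_ratio N L \<sigma>\<^sub>w \<sigma>\<^sub>b r l))"
    using assms by (intro sum_mono minus_mult_ln_ge layer_ratio_pos) auto
  then show ?thesis
    by (simp add: ring_energy_eq_sum_layer_ratio[OF assms(2,3)])
qed

lemma ring_energy_const_config: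
  fixes N :: nat and c \<sigma>\<^sub>w \<sigma>\<^sub>b :: real
  defines "t \<equiv> c\<^sup>2 / (\<sigma>\<^sub>w\<^sup>2 / real N * c\<^sup>2 + \<sigma>\<^sub>b\<^sup>2)"
  shows "ring_energy N L \<sigma>\<^sub>w \<sigma>\<^sub>b (const_config L c) =
    real (L + 1) / 2 * (t - real N * ln t)"
  \<comment> \<open>\<open>prev_layer_le\<close> keeps the predecessor in \<open>{0..L}\<close>,
    where \<open>const_config\<close> has the value \<open>c\<close> rather than
    \<open>undefined\<close>.\<close>
  by (simp add: ring_energy_def const_config_def prev_layer_le t_def)

text \<open>Clearing the denominator cancels \<open>N\<close> against the weight variance and leaves
  a linear equation in \<open>c\<^sup>2\<close>; \<open>c > 0\<close> selects the root. One
  direction gives attainment of the lower bound, the other uniqueness.\<close>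

lemma const_ratio_eq_iff:
  fixes c :: real
  assumes "N \<ge> 1" "\<sigma>\<^sub>b\<^sup>2 > 0" "\<sigma>\<^sub>w\<^sup>2 < 1" "c > 0"
  shows "c\<^sup>2 / (\<sigma>\<^sub>w\<^sup>2 / real N * c\<^sup>2 + \<sigma>\<^sub>b\<^sup>2) = real N \<longleftrightarrow> c = sqrt (real N * \<sigma>\<^sub>b\<^sup>2 / (1 - \<sigma>\<^sub>w\<^sup>2))"
proof -
  have "c\<^sup>2 / (\<sigma>\<^sub>w\<^sup>2 / real N * c\<^sup>2 + \<sigma>\<^sub>b\<^sup>2) = real N \<longleftrightarrow>
      c\<^sup>2 = real N * (\<sigma>\<^sub>w\<^sup>2 / real N * c\<^sup>2 + \<sigma>\<^sub>b\<^sup>2)"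
    using variance_pos[OF assms(2), of \<sigma>\<^sub>w N c] by (simp add: divide_eq_eq)
  also have "\<dots> \<longleftrightarrow> c\<^sup>2 * (1 - \<sigma>\<^sub>w\<^sup>2) = real N * \<sigma>\<^sub>b\<^sup>2"
    using assms(1) by (auto simp: algebra_simps)
  also have "\<dots> \<longleftrightarrow> c\<^sup>2 = real N * \<sigma>\<^sub>b\<^sup>2 / (1 - \<sigma>\<^sub>w\<^sup>2)"
    using assms(3) by (simp add: eq_divide_eq)
  also have "\<dots> \<longleftrightarrow> c = sqrt (real N * \<sigma>\<^sub>b\<^sup>2 / (1 - \<sigma>\<^sub>w\<^sup>2))"
    using assms by (auto intro: real_sqrt_unique[symmetric])
  finally show ?thesis .
qed

theorem mainTheorem3:
  fixes N L :: nat and \<sigma>\<^sub>w \<sigma>\<^sub>b \<Delta>\<^sub>w :: real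
  assumes "N \<ge> 1"
    and "\<sigma>\<^sub>b\<^sup>2 > 0"
    and "0 < \<sigma>\<^sub>w\<^sup>2" and "\<sigma>\<^sub>w\<^sup>2 < 1"
    and "\<Delta>\<^sub>w = 1 - \<sigma>\<^sub>w\<^sup>2"
  shows "\<exists>rs>0. minimizes_energy N L \<sigma>\<^sub>w \<sigma>\<^sub>b (const_config L rs)
     \<and> (\<forall>c>0. minimizes_energy N L \<sigma>\<^sub>w \<sigma>\<^sub>b (const_config L c) \<longrightarrow> c = rs)
     \<and> rs = sqrt (real N * \<sigma>\<^sub>b\<^sup>2 / \<Delta>\<^sub>w)"
proof -
  let ?E = "ring_energy N L \<sigma>\<^sub>w \<sigma>\<^sub>b"
  define rs where "rs = sqrt (real N * \<sigma>\<^sub>b\<^sup>2 / \<Delta>\<^sub>w)"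
  \<comment> \<open>The bound of \<open>ring_energy_ge\<close>, that is, the energy when every ratio
    equals \<open>N\<close>.\<close>
  define m where "m = real (L + 1) / 2 * (real N - real N * ln (real N))"
  have rs_pos: "rs > 0"
    using assms by (simp add: rs_def)
  have "rs\<^sup>2 / (\<sigma>\<^sub>w\<^sup>2 / real N * rs\<^sup>2 + \<sigma>\<^sub>b\<^sup>2) = real N"
    using const_ratio_eq_iff[OF assms(1,2,4) rs_pos] assms(5) by (simp add: rs_def)
  then have E_rs: "?E (const_config L rs) = m"
    unfolding ring_energy_const_config m_def by simp
  have "?E (const_config L rs) \<le> ?E s" if "s \<in> configs L" for s
    using ring_energy_ge[OF assms(1,2) that] unfolding E_rs m_def .
  then have minimizer: "minimizes_energy N L \<sigma>\<^sub>w \<sigma>\<^sub>b (const_config L rs)"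
    using const_config_in_configs[OF rs_pos]
    by (auto simp: minimizes_energy_def is_arg_min_def not_less)
  \<comment> \<open>A constant minimizer has energy at most that of \<open>rs\<close>, namely
    \<open>m\<close>, so its common ratio \<open>t\<close> attains the minimum of
    \<open>t - N * ln t\<close> and must be \<open>N\<close>.\<close>
  have unique: "c = rs" if "c > 0" "minimizes_energy N L \<sigma>\<^sub>w \<sigma>\<^sub>b (const_config L c)" for c
  proof -
    define t where "t = c\<^sup>2 / (\<sigma>\<^sub>w\<^sup>2 / real N * c\<^sup>2 + \<sigma>\<^sub>b\<^sup>2)"
    have t_pos: "t > 0"
      using variance_pos[OF assms(2), of \<sigma>\<^sub>w N c] that(1) by (simp add: t_def)
    have "?E (const_config L c) \<le> ?E (const_config L rs)"
      using that(2) const_config_in_configs[OF rs_pos, of L]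
      by (auto simp: minimizes_energy_def is_arg_min_def not_less)
    then have "real (L + 1) / 2 * (t - real N * ln t) \<le> m"
      unfolding E_rs by (simp only: ring_energy_const_config t_def)
    then have "t - real N * ln t \<le> real N - real N * ln (real N)"
      unfolding m_def by (rule mult_left_le_imp_le) simp
    moreover have "real N - real N * ln (real N) \<le> t - real N * ln t"
      using assms(1) t_pos by (intro minus_mult_ln_ge) auto
    ultimately have "t - real N * ln t = real N - real N * ln (real N)"
      by (rule antisym)
    then have "t = real N"
      using assms(1) by (intro minus_mult_ln_eq_imp_eq[OF _ t_pos]) auto
    then show "c = rs"
      using const_ratio_eq_iff[OF assms(1,2,4) that(1)] assms(5) by (simp add: t_def rs_def)
  qed
  from rs_pos minimizer unique show ?thesis
    unfolding rs_def by blast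
qed

end
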